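(* Let $\alpha,\Theta\in\mathcal F_{\overline{\mathcal V}\times\overline{\mathcal V}}$ with $\alpha(y,x)=-\alpha(x,y)$ and $\Theta(x,y)=\Theta(y,x)\ge 0$ for all $x,y\in\overline{\mathcal V}$, and assume $\alpha(x,y)=0$ for all $x,y\in\mathcal V^{\alpha}_{\mathcal I}$. Let $\Omega\in\mathcal F_{\mathcal V\times\mathcal V}$ be given by $\Omega(x,y)=\Theta(x,y)\alpha^2(x,y)$ if $x\ne y$ and $\Omega(x,x)=\Theta(x,x)$, and let $\lambda(x)=\sum_{y\in\overline{\mathcal V}}\Theta(x,y)\alpha^2(x,y)+\Theta(x,x)$ for $x\in\mathcal V$. Then the flow $$\dot S=R_S(\Omega S),\qquad S(0)=\exp_{\mathbb 1_{\mathcal W}}(-\Omega D_{\mathcal X})$$ on $\mathcal W$ admits the following equivalent representation: a differentiable curve $t\mapsto S(t)\in\mathcal W$, written $S(x,t)=S(t)(x)$, solves the flow if and only if, with $\overline S$ the extension of $S$ by zero from $\mathcal V$ to $\overline{\mathcal V}$, $$\partial_t S(x,t)=R_{S(x,t)}\Big(\tfrac12\mathcal D^{\alpha}\big(\Theta\,\mathcal G^{\alpha}(\overline S)\big)+\lambda S\Big)(x,t)\quad\text{on }\mathcal V\times\mathbb R_+,$$ $$\overline S(x,t)=0\quad\text{on }\mathcal V^{\alpha}_{\mathcal I}\times\mathbb R_+,$$ and at time $t=0$, $\overline S(\cdot,0)$ equals on $\overline{\mathcal V}$ the zero extension of the initial value $S(0)=\exp_{\mathbb 1_{\mathcal W}}(-\Omega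 D_{\mathcal X})$.
   Context: $\mathcal V\subset\mathbb Z^d$ ($d\ge2$) is a finite vertex set, $n=|\mathcal V|$. For sets $A$ and $E$: $\mathcal F_{A}$ is the space of functions $A\to\mathbb R$, $\mathcal F_{A,E}$ that of functions $A\to E$. Given an antisymmetric mapping $\alpha$ (regarded as a function of pairs of points in $\mathbb Z^d$, extended by $0$), the nonlocal interaction domain is $\mathcal V^{\alpha}_{\mathcal I}=\{x\in\mathbb Z^d\setminus\mathcal V:\alpha(x,y)\ne0\text{ for some }y\in\mathcal V\}$, and $\overline{\mathcal V}=\mathcal V\,\dot\cup\,\mathcal V^{\alpha}_{\mathcal I}$ (a finite set). Nonlocal operators: for $F\in\mathcal F_{\overline{\mathcal V}\times\overline{\mathcal V}}$, $\mathcal D^{\alpha}(F)(x)=\sum_{y\in\overline{\mathcal V}}\big(F(x,y)\alpha(x,y)-F(y,x)\alpha(y,x)\big)$ for $x\in\overline{\mathcal V}$; for $f\in\mathcal F_{\overline{\mathcal V}}$, $\mathcal G^{\alpha}(f)(x,y)=(f(y)-f(x))\alpha(x,y)$. Both act componentwise on $\mathbb R^c$-valued functions; $\Theta\,\mathcal G^\alpha(f)$ is the pointwise product. $c$ is the number of labels, $\Delta_c$ the probability simplex in $\mathbb R^c$, $\mathcal S$ its relative interior, and $\mathcal W=\mathcal S\times\dots\times\mathcal S$ ($n$ factors, indexed by $x\in\mathcal V$); points $S\in\mathcal W$ are $n\times c$ matrices with rows $S(x)\in\mathcal S$. $R_p=\mathrm{Diag}(p)-pp^{\top}$ for $p\in\mathcal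 S$, $(\Omega S)(x)=\sum_{y\in\mathcal V}\Omega(x,y)S(y)$ and $R_S(\Omega S)(x)=R_{S(x)}((\Omega S)(x))$. The lifting map is $\exp_p(v)=\frac{p\odot e^{v}}{\langle p,e^{v}\rangle}$ ($\odot$ and $e^v$ componentwise; the same formula is used for any $v\in\mathbb R^c$), applied row-wise for matrices; $\mathbb 1_{\mathcal W}\in\mathcal W$ has all rows equal to $\frac1c(1,\dots,1)^\top$. $D_{\mathcal X}\in\mathbb R^{n\times c}$ is a given data (distance) matrix. *)

theory Defs
  imports "HOL-Analysis.Analysis"
begin

text \<open>
  The grid is \<^typ>\<open>int ^ 'd\<close>, and a point of the label space is a vector in \<^typ>\<open>real ^ 'c\<close>.
  A function in \<open>F\<^sub>A\<close>, or a matrix with rows indexed by \<open>A\<close>, is a total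
  function of which only the values on \<open>A\<close> are ever used. The exception is
  \<open>\<alpha>\<close>, which is regarded as extended by zero to all pairs of grid points, since
  \<open>interaction_domain\<close> reads its values off \<open>V\<close>.
\<close>

definition interaction_domain ::
    "('v \<Rightarrow> 'v \<Rightarrow> real) \<Rightarrow> 'v set \<Rightarrow> 'v set" where
  "interaction_domain \<alpha> V = {x. x \<notin> V \<and> (\<exists>y\<in>V. \<alpha> x y \<noteq> 0)}"

definition extended_domain ::
    "('v \<Rightarrow> 'v \<Rightarrow> real) \<Rightarrow> 'v set \<Rightarrow> 'v set" where
  "extended_domain \<alpha> V = V \<union> interaction_domain \<alpha> V"

text \<open>
  The codomain \<open>'b\<close> is \<^typ>\<open>real\<close> for the scalar operators and \<^typ>\<open>real ^ 'c\<close> for their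
  componentwise action; the two component lemmas below relate these instances.
\<close>

definition nl_divergence ::
    "('v \<Rightarrow> 'v \<Rightarrow> real) \<Rightarrow> 'v set \<Rightarrow> ('v \<Rightarrow> 'v \<Rightarrow> 'b::real_vector) \<Rightarrow> 'v \<Rightarrow> 'b" where
  "nl_divergence \<alpha> V F x =
     (\<Sum>y\<in>extended_domain \<alpha> V. \<alpha> x y *\<^sub>R F x y - \<alpha> y x *\<^sub>R F y x)"

definition nl_gradient ::
    "('v \<Rightarrow> 'v \<Rightarrow> real) \<Rightarrow> ('v \<Rightarrow> 'b::real_vector) \<Rightarrow> 'v \<Rightarrow> 'v \<Rightarrow> 'b" where
  "nl_gradient \<alpha> f x y = \<alpha> x y *\<^sub>R (f y - f x)"

lemma nl_divergence_component:
  fixes F :: "'v \<Rightarrow> 'v \<Rightarrow> real ^ 'c"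
  shows "nl_divergence \<alpha> V F x $ i = nl_divergence \<alpha> V (\<lambda>x y. F x y $ i) x"
  by (simp add: nl_divergence_def)

lemma nl_gradient_component:
  fixes f :: "'v \<Rightarrow> real ^ 'c"
  shows "nl_gradient \<alpha> f x y $ i = nl_gradient \<alpha> (\<lambda>x. f x $ i) x y"
  by (simp add: nl_gradient_def)

definition zero_extension :: "'v set \<Rightarrow> ('v \<Rightarrow> 'b::zero) \<Rightarrow> 'v \<Rightarrow> 'b" where
  "zero_extension V f x = (if x \<in> V then f x else 0)"

definition avg_weight ::
    "('v \<Rightarrow> 'v \<Rightarrow> real) \<Rightarrow> ('v \<Rightarrow> 'v \<Rightarrow> real) \<Rightarrow> 'v \<Rightarrow> 'v \<Rightarrow> real" where
  "avg_weight \<alpha> \<Theta> x y = (if x = y then \<Theta> x x else \<Theta> x y * (\<alpha> x y)\<^sup>2)"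

definition reaction_weight ::
    "('v \<Rightarrow> 'v \<Rightarrow> real) \<Rightarrow> ('v \<Rightarrow> 'v \<Rightarrow> real) \<Rightarrow> 'v set \<Rightarrow> 'v \<Rightarrow> real" where
  "reaction_weight \<alpha> \<Theta> V x =
     (\<Sum>y\<in>extended_domain \<alpha> V. \<Theta> x y * (\<alpha> x y)\<^sup>2) + \<Theta> x x"

definition prob_simplex :: "(real ^ 'c) set" where
  "prob_simplex = {p. (\<forall>i. 0 \<le> p $ i) \<and> (\<Sum>i\<in>UNIV. p $ i) = 1}"

definition assignment_manifold :: "'v set \<Rightarrow> ('v \<Rightarrow> real ^ 'c) set" where
  "assignment_manifold V = {S. \<forall>x\<in>V. S x \<in> rel_interior prob_simplex}"

definition barycenter :: "'v \<Rightarrow> real ^ 'c" where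
  "barycenter x = (\<chi> i. 1 / real CARD('c))"

definition replicator :: "real ^ 'c \<Rightarrow> real ^ 'c ^ 'c" where
  "replicator p = (\<chi> i j. (if i = j then p $ i else 0) - p $ i * p $ j)"

definition avg_op ::
    "'v set \<Rightarrow> ('v \<Rightarrow> 'v \<Rightarrow> real) \<Rightarrow> ('v \<Rightarrow> real ^ 'c) \<Rightarrow> 'v \<Rightarrow> real ^ 'c" where
  "avg_op V \<Omega> S x = (\<Sum>y\<in>V. \<Omega> x y *\<^sub>R S y)"

definition exp_lift :: "real ^ 'c \<Rightarrow> real ^ 'c \<Rightarrow> real ^ 'c" where
  "exp_lift p v = (\<chi> i. p $ i * exp (v $ i) / (p \<bullet> (\<chi> j. exp (v $ j))))"

definition initial_assignment ::
    "'v set \<Rightarrow> ('v \<Rightarrow> 'v \<Rightarrow> real) \<Rightarrow> ('v \<Rightarrow> real ^ 'c) \<Rightarrow> 'v \<Rightarrow> real ^ 'c" where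
  "initial_assignment V \<Omega> D x = exp_lift (barycenter x) (- avg_op V \<Omega> D x)"

end

theory Submission
  imports Defs
begin

text \<open>
  The two flows have the same right-hand side. Under the symmetry conditions the flux
  \<open>\<Theta> \<G>\<^sup>\<alpha>(f)\<close> is a symmetric weight times a product of two antisymmetric factors. Hence
  it is symmetric, while \<open>\<alpha>\<close> is antisymmetric, so that both halves of the
  divergence contribute equally and \<open>1/2 \<D>\<^sup>\<alpha>(\<Theta> \<G>\<^sup>\<alpha>(f))\<close> is the graph Laplacian with weights
  \<open>\<Theta> \<alpha>\<^sup>2\<close> on the extended domain
  (lemma \<open>half_nl_divergence_weighted_nl_gradient\<close>). Its diagonal part is
  \<open>- (\<Sum>\<^sub>y \<Theta> \<alpha>\<^sup>2) f(x)\<close>, which the reaction term \<open>\<lambda> f\<close> cancels up to \<open>\<Theta>(x,x) f(x)\<close>. What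
  remains is the average with weights \<open>\<Omega>\<close>: an antisymmetric \<open>\<alpha>\<close> vanishes on the diagonal, so
  that \<open>\<Theta>(x,x)\<close> is the whole weight of \<open>f(x)\<close>, and the zero extension removes the terms
  over the interaction domain (lemma \<open>nl_diffusion_reaction_eq_avg_op\<close>).

  The boundary condition holds for every zero extension, and the two initial conditions
  agree because both extensions vanish off \<open>V\<close>.
\<close>

text \<open>
  Swapping \<open>x\<close> and \<open>y\<close> reverses the sign of \<open>\<alpha>\<close> and of the difference of \<open>f\<close>, so each
  product of \<open>\<alpha>\<close> with the flux, being of degree three in these signs, is antisymmetric. The
  subtraction in the divergence doubles it, which the factor \<open>1/2\<close> undoes.
\<close>

lemma half_nl_divergence_weighted_nl_gradient:
  fixes f :: "'v \<Rightarrow> 'b::real_vector"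
  assumes "\<And>y. y \<in> extended_domain \<alpha> V \<Longrightarrow> \<alpha> y x = - \<alpha> x y"
    and "\<And>y. y \<in> extended_domain \<alpha> V \<Longrightarrow> \<Theta> y x = \<Theta> x y"
  shows "(1/2) *\<^sub>R nl_divergence \<alpha> V (\<lambda>x y. \<Theta> x y *\<^sub>R nl_gradient \<alpha> f x y) x
       = (\<Sum>y\<in>extended_domain \<alpha> V. (\<Theta> x y * (\<alpha> x y)\<^sup>2) *\<^sub>R (f y - f x))"
  unfolding nl_divergence_def scaleR_sum_right
proof (rule sum.cong[OF refl])
  fix y assume y: "y \<in> extended_domain \<alpha> V"
  let ?a = "(\<Theta> x y * (\<alpha> x y)\<^sup>2) *\<^sub>R (f y - f x)"
  have "\<alpha> x y *\<^sub>R \<Theta> x y *\<^sub>R nl_gradient \<alpha> f x y = ?a"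
    by (simp add: nl_gradient_def power2_eq_square mult_ac)
  moreover have "\<alpha> y x *\<^sub>R \<Theta> y x *\<^sub>R nl_gradient \<alpha> f y x = - ?a"
    using assms[OF y]
    by (simp add: nl_gradient_def power2_eq_square mult_ac flip: scaleR_minus_right)
  ultimately show "(1/2) *\<^sub>R (\<alpha> x y *\<^sub>R \<Theta> x y *\<^sub>R nl_gradient \<alpha> f x y
      - \<alpha> y x *\<^sub>R \<Theta> y x *\<^sub>R nl_gradient \<alpha> f y x) = ?a"
    by (simp flip: scaleR_2)
qed

text \<open>
  The reaction weight is the degree of \<open>x\<close> in the graph with edge weights \<open>\<Theta> \<alpha>\<^sup>2\<close>, increased
  by the self-weight \<open>\<Theta>(x,x)\<close>. Adding it turns the graph Laplacian into an average; the
  degree also counts edges into the interaction domain, where the neighbour carries the value 0.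
\<close>

lemma nl_diffusion_reaction_eq_avg_op:
  fixes f :: "'v \<Rightarrow> real ^ 'c"
  assumes fin: "finite (extended_domain \<alpha> V)" and x: "x \<in> V"
    and anti: "\<And>y. y \<in> extended_domain \<alpha> V \<Longrightarrow> \<alpha> y x = - \<alpha> x y"
    and sym: "\<And>y. y \<in> extended_domain \<alpha> V \<Longrightarrow> \<Theta> y x = \<Theta> x y"
  shows "(1/2) *\<^sub>R nl_divergence \<alpha> V
            (\<lambda>x y. \<Theta> x y *\<^sub>R nl_gradient \<alpha> (zero_extension V f) x y) x
          + reaction_weight \<alpha> \<Theta> V x *\<^sub>R f x
       = avg_op V (avg_weight \<alpha> \<Theta>) f x"
proof -
  let ?E = "extended_domain \<alpha> V" and ?w = "\<lambda>y. \<Theta> x y * (\<alpha> x y)\<^sup>2"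
  have sub: "V \<subseteq> ?E"
    by (simp add: extended_domain_def)
  then have finV: "finite V"
    using fin by (rule finite_subset)
  have diag: "\<alpha> x x = 0"
    using anti[of x] x sub by auto
  have "(1/2) *\<^sub>R nl_divergence \<alpha> V
            (\<lambda>x y. \<Theta> x y *\<^sub>R nl_gradient \<alpha> (zero_extension V f) x y) x
          + reaction_weight \<alpha> \<Theta> V x *\<^sub>R f x
      = (\<Sum>y\<in>?E. ?w y *\<^sub>R (zero_extension V f y - f x)) + (sum ?w ?E + \<Theta> x x) *\<^sub>R f x"
    using half_nl_divergence_weighted_nl_gradient[of \<alpha> V x \<Theta> "zero_extension V f"] anti sym x
    by (simp add: reaction_weight_def zero_extension_def)
  also have "\<dots> = (\<Sum>y\<in>?E. ?w y *\<^sub>R zero_extension V f y) + \<Theta> x x *\<^sub>R f x"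
    by (simp add: scaleR_diff_right sum_subtractf scaleR_add_left scaleR_sum_left)
  also have "(\<Sum>y\<in>?E. ?w y *\<^sub>R zero_extension V f y) = (\<Sum>y\<in>V. ?w y *\<^sub>R f y)"
    using fin sub by (intro sum.mono_neutral_cong_right) (auto simp: zero_extension_def)
  also have "\<dots> = (\<Sum>y\<in>V - {x}. avg_weight \<alpha> \<Theta> x y *\<^sub>R f y)"
    using finV diag
    by (intro sum.mono_neutral_cong_right) (auto simp: avg_weight_def)
  also have "\<dots> + \<Theta> x x *\<^sub>R f x = avg_op V (avg_weight \<alpha> \<Theta>) f x"
    using finV x by (simp add: avg_op_def sum.remove[of V x] avg_weight_def)
  finally show ?thesis .
qed

theorem proposition3p3:
  fixes V :: "(int ^ 'd) set"
    and \<alpha> \<Theta> \<Omega> :: "int ^ 'd \<Rightarrow> int ^ 'd \<Rightarrow> real"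
    and \<Lambda> :: "int ^ 'd \<Rightarrow> real"
    and D :: "int ^ 'd \<Rightarrow> real ^ 'c"
    and S :: "real \<Rightarrow> int ^ 'd \<Rightarrow> real ^ 'c"
  defines "\<Omega> \<equiv> avg_weight \<alpha> \<Theta>"
    and "\<Lambda> \<equiv> reaction_weight \<alpha> \<Theta> V"
  assumes "CARD('d) \<ge> 2"
    and "finite V"
    and "finite (extended_domain \<alpha> V)"
    and "\<And>x y. x \<notin> extended_domain \<alpha> V \<or> y \<notin> extended_domain \<alpha> V \<Longrightarrow> \<alpha> x y = 0"
    and "\<And>x y. x \<in> extended_domain \<alpha> V \<Longrightarrow> y \<in> extended_domain \<alpha> V \<Longrightarrow> \<alpha> y x = - \<alpha> x y"
    and "\<And>x y. x \<in> extended_domain \<alpha> V \<Longrightarrow> y \<in> extended_domain \<alpha> V \<Longrightarrow> \<Theta> x y = \<Theta> y x"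
    and "\<And>x y. x \<in> extended_domain \<alpha> V \<Longrightarrow> y \<in> extended_domain \<alpha> V \<Longrightarrow> \<Theta> x y \<ge> 0"
    and "\<And>x y. x \<in> interaction_domain \<alpha> V \<Longrightarrow> y \<in> interaction_domain \<alpha> V \<Longrightarrow> \<alpha> x y = 0"
    and "\<And>t. t \<ge> 0 \<Longrightarrow> S t \<in> assignment_manifold V"
    and "\<And>x. x \<in> V \<Longrightarrow> (\<lambda>t. S t x) differentiable_on {0..}"
  shows
    "((\<forall>t\<ge>0. \<forall>x\<in>V. ((\<lambda>s. S s x) has_vector_derivative
          replicator (S t x) *v avg_op V \<Omega> (S t) x) (at t within {0..})) \<and>
      (\<forall>x\<in>V. S 0 x = initial_assignment V \<Omega> D x))
     \<longleftrightarrow>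
     ((\<forall>t\<ge>0. \<forall>x\<in>V. ((\<lambda>s. S s x) has_vector_derivative
          replicator (S t x) *v
            ((1/2) *\<^sub>R nl_divergence \<alpha> V
                (\<lambda>x y. \<Theta> x y *\<^sub>R nl_gradient \<alpha> (zero_extension V (S t)) x y) x
             + \<Lambda> x *\<^sub>R S t x)) (at t within {0..})) \<and>
      (\<forall>t\<ge>0. \<forall>x\<in>interaction_domain \<alpha> V. zero_extension V (S t) x = 0) \<and>
      (\<forall>x\<in>extended_domain \<alpha> V. zero_extension V (S 0) x
          = zero_extension V (initial_assignment V \<Omega> D) x))"
proof -
  have inV: "x \<in> extended_domain \<alpha> V" if "x \<in> V" for x
    using that by (simp add: extended_domain_def)
  have "(1/2) *\<^sub>R nl_divergence \<alpha> V
            (\<lambda>x y. \<Theta> x y *\<^sub>R nl_gradient \<alpha> (zero_extension V (S t)) x y) x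
          + \<Lambda> x *\<^sub>R S t x = avg_op V \<Omega> (S t) x" if "x \<in> V" for t x
    unfolding \<Omega>_def \<Lambda>_def
    using that assms(5) assms(7,8)[OF inV[OF that]]
    by (intro nl_diffusion_reaction_eq_avg_op) auto
  moreover have "zero_extension V (S t) x = 0" if "x \<in> interaction_domain \<alpha> V" for t x
    using that by (simp add: interaction_domain_def zero_extension_def)
  moreover have "(\<forall>x\<in>V. S 0 x = initial_assignment V \<Omega> D x) \<longleftrightarrow>
      (\<forall>x\<in>extended_domain \<alpha> V. zero_extension V (S 0) x
          = zero_extension V (initial_assignment V \<Omega> D) x)"
    using inV by (auto simp: zero_extension_def)
  ultimately show ?thesis
    by simp
qed

end
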